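(* Every nondeterministic thrifty $k$-way branching program solving $BT^4_2(k)$ has $\Omega(k^3)$ states (as $k\to\infty$).
   Context: Let $[k]=\{1,\dots,k\}$. $T^4_2$ is the balanced rooted binary tree with 4 levels, nodes numbered heap-style: root $1$, children of node $i$ are $2i,2i+1$. An instance assigns to each internal node $i$ a function $f_i:[k]^2\to[k]$ (given by its $k^2$ values) and to each leaf an element of $[k]$; $v_i$ is the leaf label for a leaf and $v_i=f_i(v_{2i},v_{2i+1})$ otherwise. $BT^4_2(k)$: decide whether $v_1=1$. The $k$-ary input variables are $f_i(a,b)$ ($i$ internal, $a,b\in[k]$) and one per leaf. A nondeterministic $k$-way branching program computing $g:[k]^m\to R$ is a directed rooted multigraph of states; edges are labelled by elements of $[k]$; every state is labelled by a variable index in $[m]$ except $|R|$ final sink states labelled by elements of $R$. On input $x$, edges labelled $x_j$ leaving states labelled $j$ are activated; a computation is a path of activated edges from the root, which is infinite, ends in the final state labelled $g(x)$, or ends at a nonfinal state labelled $j$ with no outedge labelled $x_j$; at least one computation must end in a final state. Such a program solving $BT^4_2(k)$ is thrifty if, for every input, every computation ending in a final state only queries internal-node variables $f_i(a,b)$ with $(a,b)=(v_{2i},v_{2i+1})$. *)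

theory Defs
  imports "Graph_Theory.Arc_Walk" "HOL-Library.FuncSet"
begin

section \<open>Nondeterministic k-way branching programs\<close>

datatype ('x, 'r) state_label = Query 'x | Final 'r

text \<open>The field \<open>graph\<close> is a multigraph: its arcs form a set of their own, with tail and head
  maps, so parallel arcs (with equal or different labels) are allowed.\<close>

record ('q, 'e, 'x, 'r) nbp =
  graph :: "('q, 'e) pre_digraph"
  start :: 'q
  slabel :: "'q \<Rightarrow> ('x, 'r) state_label"
  elabel :: "'e \<Rightarrow> nat"

definition is_nbp :: "nat \<Rightarrow> 'x set \<Rightarrow> 'r set \<Rightarrow> ('q, 'e, 'x, 'r) nbp \<Rightarrow> bool" where
  "is_nbp k X R B \<longleftrightarrow>
     wf_digraph (graph B) \<and> finite (verts (graph B)) \<and> start B \<in> verts (graph B) \<and>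
     (\<forall>e \<in> arcs (graph B). elabel B e \<in> {1..k}) \<and>
     (\<forall>q \<in> verts (graph B). \<forall>j. slabel B q = Query j \<longrightarrow> j \<in> X) \<and>
     (\<forall>q \<in> verts (graph B). \<forall>r. slabel B q = Final r \<longrightarrow>
        r \<in> R \<and> out_arcs (graph B) q = {}) \<and>
     (\<forall>r \<in> R. \<exists>!q. q \<in> verts (graph B) \<and> slabel B q = Final r)"

definition nbp_size :: "('q, 'e, 'x, 'r) nbp \<Rightarrow> nat" where
  "nbp_size B = card (verts (graph B))"

text \<open>The inputs, i.e. the elements of \<open>[k]\<^sup>m\<close>, with the coordinates indexed by a set \<open>X\<close> of
  \<open>m\<close> variables.\<close>

definition inputs :: "nat \<Rightarrow> 'x set \<Rightarrow> ('x \<Rightarrow> nat) set" where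
  "inputs k X = X \<rightarrow>\<^sub>E {1..k}"

definition activated :: "('q, 'e, 'x, 'r) nbp \<Rightarrow> ('x \<Rightarrow> nat) \<Rightarrow> 'e \<Rightarrow> bool" where
  "activated B x e \<longleftrightarrow> e \<in> arcs (graph B) \<and>
     (\<exists>j. slabel B (tail (graph B) e) = Query j \<and> elabel B e = x j)"

text \<open>The finite computations: maximal paths of activated arcs from the start state. The arcs
  traversed are \<open>p\<close> and \<open>q\<close> is the last state. Infinite paths of activated arcs are computations
  as well, but neither correctness nor thriftiness constrains them.\<close>

definition fin_computation ::
  "('q, 'e, 'x, 'r) nbp \<Rightarrow> ('x \<Rightarrow> nat) \<Rightarrow> 'e list \<Rightarrow> 'q \<Rightarrow> bool" where
  "fin_computation B x p q \<longleftrightarrow>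
     pre_digraph.awalk (graph B) (start B) p q \<and>
     (\<forall>e \<in> set p. activated B x e) \<and>
     (\<forall>e \<in> out_arcs (graph B) q. \<not> activated B x e)"

text \<open>A finite computation ending in a query state aborts there, which is allowed. One ending in
  a final state must give the correct answer.\<close>

definition computes ::
  "nat \<Rightarrow> 'x set \<Rightarrow> 'r set \<Rightarrow> (('x \<Rightarrow> nat) \<Rightarrow> 'r) \<Rightarrow> ('q, 'e, 'x, 'r) nbp \<Rightarrow> bool" where
  "computes k X R g B \<longleftrightarrow>
     is_nbp k X R B \<and>
     (\<forall>x \<in> inputs k X.
        (\<forall>p q. fin_computation B x p q \<longrightarrow>
           slabel B q = Final (g x) \<or> (\<exists>j. slabel B q = Query j)) \<and>
        (\<exists>p q r. fin_computation B x p q \<and> slabel B q = Final r))"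


section \<open>Tree evaluation on the binary tree with 4 levels\<close>

text \<open>Internal nodes are 1 to 7 and leaves 8 to 15. \<open>Fn i a b\<close> stands for the variable
  \<open>f\<^sub>i(a,b)\<close>.\<close>

datatype bt_var = Fn nat nat nat | Leaf nat

definition bt_vars :: "nat \<Rightarrow> bt_var set" where
  "bt_vars k = {Fn i a b | i a b. i \<in> {1..7} \<and> a \<in> {1..k} \<and> b \<in> {1..k}} \<union> Leaf ` {8..15}"

function node_val :: "(bt_var \<Rightarrow> nat) \<Rightarrow> nat \<Rightarrow> nat" where
  "node_val x i =
     (if i \<in> {1..7} then x (Fn i (node_val x (2 * i)) (node_val x (2 * i + 1))) else x (Leaf i))"
  by pat_completeness auto
termination by (relation "measure (\<lambda>(x, i). 16 - i)") auto

declare node_val.simps [simp del]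

definition solves_BT :: "nat \<Rightarrow> ('q, 'e, bt_var, bool) nbp \<Rightarrow> bool" where
  "solves_BT k B \<longleftrightarrow> computes k (bt_vars k) UNIV (\<lambda>x. node_val x 1 = 1) B"

text \<open>The variables queried by a computation ending in a final state are the labels of the tails
  of its arcs.\<close>

definition thrifty :: "nat \<Rightarrow> ('q, 'e, bt_var, bool) nbp \<Rightarrow> bool" where
  "thrifty k B \<longleftrightarrow>
     (\<forall>x \<in> inputs k (bt_vars k). \<forall>p q r. fin_computation B x p q \<and> slabel B q = Final r \<longrightarrow>
        (\<forall>e \<in> set p. \<forall>i a b. slabel B (tail (graph B) e) = Query (Fn i a b) \<longrightarrow>
           (a, b) = (node_val x (2 * i), node_val x (2 * i + 1))))"

end

theory Submission imports Defs begin

text \<open>Restrict to inputs with constant functions \<open>f\<^sub>i = v\<^sub>i\<close> and \<open>v\<^sub>1 = 1\<close>, of which there are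
  \<open>k\<^sup>1\<^sup>4\<close>, and fix an accepting computation for each. Whatever the order in which it queries the nodes,
  there are two nodes \<open>J\<close> and two states \<open>s\<close>, \<open>t\<close> of the computation such that between \<open>s\<close> and \<open>t\<close>
  the parents of \<open>J\<close> are queried but \<open>J\<close> is not, and \<open>s\<close>, \<open>t\<close> are end states of the computation
  or query internal nodes whose children are not in \<open>J\<close>. For fixed values outside \<open>J\<close>, the values
  on \<open>J\<close> are determined by \<open>(s, t)\<close>, since otherwise splicing two computations violates
  thriftiness. So about \<open>k\<close> different states occur as \<open>s\<close> or as \<open>t\<close>. All of them carry the same two
  values of the children of the queried node, and there are \<open>k\<^sup>2\<close> choices for these.\<close>

section \<open>Cutting the sequence of queried nodes\<close>

text \<open>By thriftiness a state querying node \<open>i\<close> is labelled by the values of the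
  children of \<open>i\<close>. For a good node this label depends only on values outside
  \<open>J\<close>.\<close>

definition good :: "nat set \<Rightarrow> nat \<Rightarrow> bool" where
  "good J i \<longleftrightarrow> i \<in> {1..7} \<and> 2 * i \<notin> J \<and> 2 * i + 1 \<notin> J"

text \<open>Here \<open>w n\<close> is the node queried at step \<open>n\<close> of a computation of length \<open>L\<close>.\<close>

definition cut :: "(nat \<Rightarrow> nat) \<Rightarrow> nat \<Rightarrow> nat set \<Rightarrow> nat \<Rightarrow> nat \<Rightarrow> bool" where
  "cut w L J a b \<longleftrightarrow> a \<le> b \<and> b \<le> L \<and> (\<forall>n \<in> {a..<b}. w n \<notin> J) \<and>
     (\<forall>j \<in> J. \<exists>n \<in> {a..<b}. w n = j div 2) \<and> (a = 0 \<or> good J (w a)) \<and> (b = L \<or> good J (w b))"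

text \<open>These are the sibling pairs, and the pairs of one child \<open>d\<close> of the root
  with a child of the other.\<close>

definition cut_pairs :: "nat set set" where
  "cut_pairs = {{2, 3}, {4, 5}, {6, 7}, {2, 6}, {2, 7}, {3, 4}, {3, 5}}"

lemma next_occurrence:
  fixes T L :: nat
  assumes "T < L"
  obtains b where "T < b" "b \<le> L" "\<forall>n \<in> {T<..<b}. w n \<notin> K" "b = L \<or> w b \<in> K"
proof -
  let ?P = "\<lambda>b. T < b \<and> (b = L \<or> w b \<in> K)"
  have P: "?P L" using assms by simp
  define b where "b = (LEAST b. ?P b)"
  have "?P b" unfolding b_def by (rule LeastI[of ?P, OF P])
  moreover have "b \<le> L" unfolding b_def by (rule Least_le[of ?P, OF P])
  moreover have "w n \<notin> K" if "n \<in> {T<..<b}" for n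
    using that not_less_Least[of n ?P] by (auto simp flip: b_def)
  ultimately show ?thesis using that by blast
qed

lemma last_occurrence:
  fixes T :: nat
  obtains (none) "\<forall>n < T. w n \<notin> K"
  | (last) a where "a < T" "w a \<in> K" "\<forall>n \<in> {a<..<T}. w n \<notin> K"
proof (cases "\<forall>n < T. w n \<notin> K")
  case False
  let ?A = "{n. n < T \<and> w n \<in> K}"
  have f: "finite ?A" and "?A \<noteq> {}" using False by auto
  then have "Max ?A \<in> ?A" by (rule Max_in)
  moreover have "w n \<notin> K" if "n \<in> {Max ?A<..<T}" for n
    using that Max_ge[OF f, of n] by (auto simp: not_less[symmetric])
  ultimately show ?thesis using last by blast
qed (use none in blast)

text \<open>Fractional pebbling bound in combinatorial form: \<open>T\<close> is a query of the root, \<open>c\<close> the child of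
  the root queried last before \<open>T\<close>, and \<open>d\<close> the other child.\<close>

lemma cut_exists_ordered:
  assumes T: "T < L" "w T = 1"
    and c: "(c, d) \<in> {(2, 3), (3, 2)}"
    and tc: "tc < T" "w tc = c" "\<forall>n \<in> {tc<..<T}. w n \<noteq> 2 \<and> w n \<noteq> 3"
  shows "\<exists>J \<in> {{2, 3}, {2 * c, 2 * c + 1}, {d, 2 * c}, {d, 2 * c + 1}}. \<exists>a b. cut w L J a b"
proof (cases "\<exists>a \<in> {tc<..<T}. w a \<in> {2 * c, 2 * c + 1}")
  case True
  \<comment> \<open>A child of \<open>c\<close> is read after the last query of \<open>c\<close>, so
    from there until a child of the root is read after \<open>T\<close>, the root is queried but
    neither 2 nor 3 is. The nodes read at \<open>a\<close> have leaves as children, hence are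
    good.\<close>
  then obtain a where a: "a \<in> {tc<..<T}" "w a \<in> {2 * c, 2 * c + 1}" by blast
  obtain b where b: "T < b" "b \<le> L" "\<forall>n \<in> {T<..<b}. w n \<notin> {2, 3}" "b = L \<or> w b \<in> {2, 3}"
    using next_occurrence[OF T(1)] .
  have "w n \<notin> {2, 3}" if "n \<in> {a..<b}" for n
    using that a T tc(3) b(3) by (cases n T rule: linorder_cases) auto
  moreover have "good {2, 3} (w a)" using a c by (auto simp: good_def)
  moreover have "b = L \<or> good {2, 3} (w b)" using b(4) by (auto simp: good_def) presburger
  moreover have "\<forall>j \<in> {2, 3}. \<exists>n \<in> {a..<b}. w n = j div 2"
    using a b(1) T(2) by (auto intro!: bexI[of _ T])
  ultimately have "cut w L {2, 3} a b" using a b by (auto simp: cut_def)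
  then show ?thesis by blast
next
  case late: False
  \<comment> \<open>Now split on the last query of \<open>?D\<close> before \<open>tc\<close>. If it
    is \<open>d\<close> or absent, the segment from there to \<open>T\<close> cuts the children of
    \<open>c\<close>. If it is a child of \<open>c\<close>, the segment starting there cuts
    \<open>d\<close> together with the other child of \<open>c\<close>.\<close>
  let ?D = "{d, 2 * c, 2 * c + 1}"
  consider (other) a where "a \<le> tc" "a = 0 \<or> w a = d"
      "\<forall>n \<in> {a..<tc}. w n \<notin> {2 * c, 2 * c + 1}"
    | (child) a where "a < tc" "w a \<in> {2 * c, 2 * c + 1}" "\<forall>n \<in> {a<..<tc}. w n \<notin> ?D"
  proof (rule last_occurrence[of tc w ?D])
    assume "\<forall>n < tc. w n \<notin> ?D"
    then show thesis using other[of 0] by simp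
  next
    fix a assume a: "a < tc" "w a \<in> ?D" "\<forall>n \<in> {a<..<tc}. w n \<notin> ?D"
    show thesis
    proof (cases "w a = d")
      case True
      have "w n \<notin> {2 * c, 2 * c + 1}" if "n \<in> {a..<tc}" for n
        using that a(3) True c by (cases "n = a") auto
      then show thesis using other[of a] a(1) True by simp
    next
      case False
      then show thesis using child[of a] a by simp
    qed
  qed
  note a_cases = this
  have midT: "w n \<notin> {d, 2 * c, 2 * c + 1}" if "n \<in> {tc..<T}" for n
    using that late tc c by (cases "n = tc") auto
  show ?thesis
  proof (rule a_cases)
    fix a assume a: "a \<le> tc" "a = 0 \<or> w a = d" "\<forall>n \<in> {a..<tc}. w n \<notin> {2 * c, 2 * c + 1}"
    let ?J = "{2 * c, 2 * c + 1}"
    have "w n \<notin> ?J" if n: "n \<in> {a..<T}" for n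
      using a(3) midT n by (cases "n < tc") auto
    moreover have "a = 0 \<or> good ?J (w a)"
      using a(2) c by (auto simp: good_def) presburger+
    moreover have "good ?J (w T)" using T c by (auto simp: good_def)
    moreover have "\<forall>j \<in> ?J. \<exists>n \<in> {a..<T}. w n = j div 2"
      using a tc by (auto intro!: bexI[of _ tc])
    ultimately have "cut w L ?J a T" using a tc T by (auto simp: cut_def)
    then show ?thesis by blast
  next
    fix a assume a: "a < tc" "w a \<in> {2 * c, 2 * c + 1}" "\<forall>n \<in> {a<..<tc}. w n \<notin> ?D"
    \<comment> \<open>The sibling of the node read at \<open>a\<close>. Its parent \<open>c\<close>
      is queried at \<open>tc\<close>, and the parent of \<open>d\<close>, the root, at
      \<open>T\<close>.\<close>
    define e where "e = (if w a = 2 * c then 2 * c + 1 else 2 * c)"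
    let ?J = "{d, e}"
    have e: "e \<in> {2 * c, 2 * c + 1}" "e \<noteq> w a" "e div 2 = c" using a(2) by (auto simp: e_def)
    obtain b where b: "T < b" "b \<le> L" "\<forall>n \<in> {T<..<b}. w n \<notin> ?J" "b = L \<or> w b \<in> ?J"
      using next_occurrence[OF T(1)] .
    have "w n \<notin> ?J" if n: "n \<in> {a..<b}" for n
    proof -
      consider "n = a" | "n \<in> {a<..<tc}" | "n \<in> {tc..<T}" | "n = T" | "n \<in> {T<..<b}"
        using n by fastforce
      then show ?thesis
      proof cases
        case 1
        then show ?thesis using e a(2) c by auto
      next
        case 2
        then show ?thesis using a e by auto
      next
        case 3
        then show ?thesis using midT e by auto
      next
        case 4
        then show ?thesis using T e c by auto
      next
        case 5
        then show ?thesis using b by auto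
      qed
    qed
    moreover have "good ?J (w a)" using a(2) c e by (auto simp: good_def)
    moreover have "b = L \<or> good ?J (w b)" using b(4) c e by (auto simp: good_def)
    moreover have "\<exists>n \<in> {a..<b}. w n = d div 2" using a tc T b c by (intro bexI[of _ T]) auto
    moreover have "\<exists>n \<in> {a..<b}. w n = e div 2" using a tc T b e by (intro bexI[of _ tc]) auto
    ultimately have "cut w L ?J a b" using a tc b by (auto simp: cut_def)
    then show ?thesis using e(1) by blast
  qed
qed

text \<open>If neither child of the root is read before \<open>T\<close>, the segment may start at 0
  and cuts \<open>{2, 3}\<close>. Otherwise the last such read determines \<open>c\<close> and
  \<open>d\<close>.\<close>

lemma cut_exists:
  assumes T: "T < L" "w T = 1"
  shows "\<exists>J \<in> cut_pairs. \<exists>a b. cut w L J a b"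
proof (rule last_occurrence[of T w "{2, 3}"])
  assume none: "\<forall>n < T. w n \<notin> {2, 3}"
  obtain b where b: "T < b" "b \<le> L" "\<forall>n \<in> {T<..<b}. w n \<notin> {2, 3}" "b = L \<or> w b \<in> {2, 3}"
    using next_occurrence[OF T(1)] .
  have "w n \<notin> {2, 3}" if "n \<in> {0..<b}" for n
    using that T none b(3) by (cases n T rule: linorder_cases) auto
  moreover have "b = L \<or> good {2, 3} (w b)" using b(4) by (auto simp: good_def) presburger
  moreover have "\<forall>j \<in> {2, 3}. \<exists>n \<in> {0..<b}. w n = j div 2"
    using b(1) T(2) by (auto intro!: bexI[of _ T])
  ultimately have "cut w L {2, 3} 0 b" using b by (auto simp: cut_def)
  then show ?thesis by (auto simp: cut_pairs_def)
next
  fix t assume t: "t < T" "w t \<in> {2, 3}" "\<forall>n \<in> {t<..<T}. w n \<notin> {2, 3}"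
  obtain c d :: nat where cd: "(c, d) \<in> {(2, 3), (3, 2)}" "w t = c" using t(2) by auto
  \<comment> \<open>Evaluating the node numbers turns each membership in \<open>cut_pairs\<close>
    into a syntactic match.\<close>
  have e: "2 * 2 = (4::nat)" "2 * 3 = (6::nat)" "4 + 1 = (5::nat)" "6 + 1 = (7::nat)" by simp_all
  consider "c = 2 \<and> d = 3" | "c = 3 \<and> d = 2" using cd(1) by auto
  then have "{{2, 3}, {2 * c, 2 * c + 1}, {d, 2 * c}, {d, 2 * c + 1}} \<subseteq> cut_pairs"
    by cases
      (simp_all only: e cut_pairs_def insert_subset empty_subsetI insert_iff simp_thms)
  moreover have "\<forall>n \<in> {t<..<T}. w n \<noteq> 2 \<and> w n \<noteq> 3" using t(3) by simp
  ultimately show ?thesis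
    using cut_exists_ordered[of T L w c d t, OF T cd(1) t(1) cd(2)] by (meson subsetD)
qed

section \<open>Inputs with constant functions\<close>

text \<open>Fixing the root value at 1 keeps only yes-instances, so their computations that end in a
  final state all end in the same one.\<close>

definition root_one_values :: "nat \<Rightarrow> nat \<Rightarrow> nat set" where
  "root_one_values k i = (if i = 1 then {1} else {1..k})"

text \<open>The root contributes a factor 1 and each of the 14 other nodes outside \<open>K\<close>
  a factor \<open>k\<close>.\<close>

lemma card_root_one_valuations:
  assumes "K \<subseteq> {2..15}"
  shows "card (Pi\<^sub>E ({1..15} - K) (root_one_values k)) = k ^ (14 - card K)"
proof -
  have fK: "finite K" using assms finite_subset by blast
  have K: "{1..15} - K = insert 1 ({2..15} - K)"
    using assms by auto
  have "card (Pi\<^sub>E ({1..15} - K) (root_one_values k))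
      = (\<Prod>i \<in> insert 1 ({2..15} - K). card (root_one_values k i))"
    unfolding K by (rule card_PiE) simp
  also have "(\<Prod>i \<in> insert 1 ({2..15} - K). card (root_one_values k i))
      = (\<Prod>i \<in> {2..15} - K. k)"
    by (simp add: root_one_values_def)
  also have "\<dots> = k ^ (14 - card K)"
    using assms fK by (simp add: card_Diff_subset)
  finally show ?thesis .
qed

text \<open>All functions are constant, so that changing one value \<open>v i\<close> changes no other node value.\<close>

definition input_of :: "nat \<Rightarrow> (nat \<Rightarrow> nat) \<Rightarrow> bt_var \<Rightarrow> nat" where
  "input_of k v = restrict (\<lambda>x. case x of Fn i a b \<Rightarrow> v i | Leaf i \<Rightarrow> v i) (bt_vars k)"

lemma input_of_Fn [simp]:
  "i \<in> {1..7} \<Longrightarrow> a \<in> {1..k} \<Longrightarrow> b \<in> {1..k} \<Longrightarrow> input_of k v (Fn i a b) = v i"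
  by (auto simp: input_of_def bt_vars_def)

lemma input_of_Leaf [simp]: "i \<in> {8..15} \<Longrightarrow> input_of k v (Leaf i) = v i"
  by (auto simp: input_of_def bt_vars_def)

lemma input_of_mem:
  assumes "v \<in> {1..15} \<rightarrow> {1..k}"
  shows "input_of k v \<in> inputs k (bt_vars k)"
  using assms unfolding inputs_def input_of_def bt_vars_def by (fastforce simp: Pi_iff)

lemma node_val_input_of:
  assumes v: "v \<in> {1..15} \<rightarrow> {1..k}" and "i \<in> {1..15}"
  shows "node_val (input_of k v) i = v i"
  using \<open>i \<in> {1..15}\<close>
proof (induction "15 - i" arbitrary: i rule: less_induct)
  case less
  show ?case
  proof (cases "i \<le> 7")
    case True
    have "node_val (input_of k v) (2 * i) = v (2 * i)"
      "node_val (input_of k v) (2 * i + 1) = v (2 * i + 1)"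
      using less True by auto
    \<comment> \<open>The arguments must lie in \<open>{1..k}\<close>, because
      \<open>input_of\<close> is \<open>undefined\<close> outside \<open>bt_vars k\<close>.\<close>
    moreover have "v (2 * i) \<in> {1..k}" "v (2 * i + 1) \<in> {1..k}"
      using v less.prems True by (auto intro!: Pi_mem[OF v])
    ultimately show ?thesis
      using less.prems True by (subst node_val.simps) auto
  next
    case False
    then show ?thesis using less.prems by (subst node_val.simps) auto
  qed
qed

section \<open>Splicing computations\<close>

text \<open>Assumption \<open>k2\<close> makes 2 a legal root value, so a yes-instance can be turned
  into a no-instance at the root.\<close>

locale thrifty_program =
  fixes k :: nat and B :: "('q, 'e, bt_var, bool) nbp"
  assumes solves: "solves_BT k B" and thrifty: "thrifty k B" and k2: "2 \<le> k"
begin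

lemma nbp: "is_nbp k (bt_vars k) UNIV B"
  using solves by (simp add: solves_BT_def computes_def)

sublocale wf_digraph "graph B"
  using nbp by (simp add: is_nbp_def)

abbreviation V :: "(nat \<Rightarrow> nat) set" where
  "V \<equiv> Pi\<^sub>E {1..15} (root_one_values k)"

lemma V_range:
  assumes "v \<in> V"
  shows "v \<in> {1..15} \<rightarrow> {1..k}"
proof (rule Pi_I)
  fix i :: nat assume "i \<in> {1..15}"
  with assms have "v i \<in> root_one_values k i" by (rule PiE_mem)
  then show "v i \<in> {1..k}" using k2 by (simp add: root_one_values_def split: if_splits)
qed

lemma V_root:
  assumes "v \<in> V"
  shows "v 1 = 1"
  using PiE_mem[OF assms, of 1] by (simp add: root_one_values_def)

section \<open>The accepting state and one chosen computation per valuation\<close>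

definition acc :: 'q where
  "acc = (THE q. q \<in> verts (graph B) \<and> slabel B q = Final True)"

lemma acc_unique: "q \<in> verts (graph B) \<Longrightarrow> slabel B q = Final True \<Longrightarrow> q = acc"
  and slabel_acc: "slabel B acc = Final True"
proof -
  have ex: "\<exists>!q. q \<in> verts (graph B) \<and> slabel B q = Final True"
    using nbp by (simp add: is_nbp_def)
  show "slabel B acc = Final True" using theI'[OF ex] by (simp add: acc_def)
  show "q \<in> verts (graph B) \<Longrightarrow> slabel B q = Final True \<Longrightarrow> q = acc"
    using the1_equality[OF ex] by (simp add: acc_def)
qed

lemma fin_computation_verts: "fin_computation B x p q \<Longrightarrow> q \<in> verts (graph B)"
  by (auto simp: fin_computation_def intro: awalk_last_in_verts)

definition run :: "(nat \<Rightarrow> nat) \<Rightarrow> 'e list" where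
  "run v = (SOME p. fin_computation B (input_of k v) p acc)"

text \<open>Some computation ends in a final state, and correctness with root value 1 forces its
  label to be \<open>True\<close>.\<close>

lemma fin_computation_run:
  assumes v: "v \<in> V"
  shows "fin_computation B (input_of k v) (run v) acc"
proof -
  have m: "input_of k v \<in> inputs k (bt_vars k)" using V_range[OF v] by (rule input_of_mem)
  obtain p q r where p: "fin_computation B (input_of k v) p q" "slabel B q = Final r"
    using solves m unfolding solves_BT_def computes_def by blast
  then have "slabel B q = Final (node_val (input_of k v) 1 = 1)"
    using solves m unfolding solves_BT_def computes_def by fastforce
  then have "slabel B q = Final True"
    using node_val_input_of[OF V_range[OF v], of 1] V_root[OF v] by simp
  then have "q = acc" using acc_unique fin_computation_verts[OF p(1)] by blast
  then show ?thesis unfolding run_def using p(1) by (metis someI)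
qed

text \<open>Leaf queries get the junk value 0: the argument never needs them.\<close>

definition qnode :: "'e \<Rightarrow> nat" where
  "qnode e = (case slabel B (tail (graph B) e) of Query (Fn i a b) \<Rightarrow> i | _ \<Rightarrow> 0)"

text \<open>Thriftiness ties the query labels to \<open>v\<close>. The computation \<open>p\<close>
  is arbitrary, so that spliced computations are covered as well as \<open>run v\<close>.\<close>

lemma slabel_tail:
  assumes v: "v \<in> V" and p: "fin_computation B (input_of k v) p acc" and e: "e \<in> set p"
    and i: "qnode e = i" "i \<in> {1..7}"
  shows "slabel B (tail (graph B) e) = Query (Fn i (v (2 * i)) (v (2 * i + 1)))"
proof -
  obtain a b where ab: "slabel B (tail (graph B) e) = Query (Fn i a b)"
    using i by (auto simp: qnode_def split: state_label.splits bt_var.splits)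
  have "(a, b) = (node_val (input_of k v) (2 * i), node_val (input_of k v) (2 * i + 1))"
    using thrifty input_of_mem[OF V_range[OF v]] p slabel_acc e ab
    unfolding thrifty_def by blast
  then show ?thesis
    using ab i(2) node_val_input_of[OF V_range[OF v]] by auto
qed

text \<open>A computation that never reads the root would also accept after the root value is
  changed to 2.\<close>

lemma root_queried:
  assumes v: "v \<in> V"
  shows "\<exists>e \<in> set (run v). qnode e = 1"
proof (rule ccontr)
  assume no: "\<not> ?thesis"
  let ?v = "v(1 := 2)"
  note p = fin_computation_run[OF v]
  have range: "?v \<in> {1..15} \<rightarrow> {1..k}" using V_range[OF v] k2 by auto
  have "input_of k ?v x = input_of k v x" if "x \<noteq> Leaf 1" "\<And>a b. x \<noteq> Fn 1 a b" for x
    using that by (auto simp: input_of_def restrict_def split: bt_var.splits)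
  \<comment> \<open>\<open>Leaf 1\<close> lies outside \<open>bt_vars k\<close>, so both sides are
    \<open>undefined\<close>.\<close>
  moreover have "input_of k ?v (Leaf 1) = input_of k v (Leaf 1)"
    by (auto simp: input_of_def bt_vars_def)
  ultimately have same: "input_of k ?v x = input_of k v x" if "\<And>a b. x \<noteq> Fn 1 a b" for x
    using that by (cases "x = Leaf 1") auto
  have "activated B (input_of k ?v) e" if e: "e \<in> set (run v)" for e
  proof -
    obtain x where "e \<in> arcs (graph B)" and x: "slabel B (tail (graph B) e) = Query x"
      "elabel B e = input_of k v x"
      using p e by (auto simp: fin_computation_def activated_def)
    moreover have "x \<noteq> Fn 1 a b" for a b using no e x by (auto simp: qnode_def)
    ultimately show ?thesis using same by (auto simp: activated_def)
  qed
  \<comment> \<open>With no arcs leaving \<open>acc\<close>, maximality of the path holds for the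
    new input too.\<close>
  moreover have "out_arcs (graph B) acc = {}"
    using nbp slabel_acc fin_computation_verts[OF p] unfolding is_nbp_def by blast
  ultimately have "fin_computation B (input_of k ?v) (run v) acc"
    using p by (simp add: fin_computation_def)
  then have "node_val (input_of k ?v) 1 = 1"
    using solves input_of_mem[OF range] slabel_acc
    unfolding solves_BT_def computes_def by fastforce
  then show False using node_val_input_of[OF range, of 1] by simp
qed

section \<open>States and segments along the chosen computations\<close>

definition st :: "(nat \<Rightarrow> nat) \<Rightarrow> nat \<Rightarrow> 'q" where
  "st v n = awlast (start B) (take n (run v))"

lemma awalk_run: "v \<in> V \<Longrightarrow> awalk (start B) (run v) acc"
  using fin_computation_run by (simp add: fin_computation_def)

lemma awalk_prefix: "v \<in> V \<Longrightarrow> awalk (start B) (take n (run v)) (st v n)"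
  and awalk_suffix: "v \<in> V \<Longrightarrow> awalk (st v n) (drop n (run v)) acc"
  using awalk_append_iff[of "start B" "take n (run v)" "drop n (run v)" acc] awalk_run
  by (auto simp: st_def)

lemma awalk_segment:
  assumes "v \<in> V" "a \<le> b"
  shows "awalk (st v a) (take (b - a) (drop a (run v))) (st v b)"
proof -
  have "take b (run v) = take a (run v) @ take (b - a) (drop a (run v))"
    using assms(2) by (metis le_add_diff_inverse take_add)
  then show ?thesis
    using awalk_prefix[OF assms(1), of b] awalk_append_iff by (simp add: st_def)
qed

lemma st_0: "st v 0 = start B"
  by (simp add: st_def)

lemma st_length: "v \<in> V \<Longrightarrow> st v (length (run v)) = acc"
  using awalk_suffix[of v "length (run v)"] by (simp add: awalk_Nil_iff)

lemma st_tail: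
  assumes "v \<in> V" "n < length (run v)"
  shows "st v n = tail (graph B) (run v ! n)"
  using awalk_suffix[OF assms(1), of n] assms(2)
  by (simp add: Cons_nth_drop_Suc[symmetric] awalk_Cons_iff)

abbreviation cut_at :: "nat set \<Rightarrow> (nat \<Rightarrow> nat) \<Rightarrow> nat \<Rightarrow> nat \<Rightarrow> bool" where
  "cut_at J v a b \<equiv> cut (\<lambda>n. qnode (run v ! n)) (length (run v)) J a b"

text \<open>The middle segment of the computation on \<open>v'\<close> reads no node of \<open>J\<close>, so it can be spliced
  into the computation on \<open>v\<close>; the parents of the nodes in \<open>J\<close> are then queried at the values of
  \<open>v'\<close>, and thriftiness on \<open>v\<close> makes these equal to the values of \<open>v\<close>.\<close>

lemma splice:
  assumes v: "v \<in> V" "v' \<in> V" and J: "J \<subseteq> {2..7}"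
    and eq: "\<And>i. i \<notin> J \<Longrightarrow> v i = v' i"
    and c: "cut_at J v a b" "cut_at J v' a' b'"
    and st: "st v a = st v' a'" "st v b = st v' b'"
  shows "v = v'"
proof -
  define m where "m = take (b' - a') (drop a' (run v'))"
  define p where "p = take a (run v) @ m @ drop b (run v)"
  have ab': "a' \<le> b'" "b' \<le> length (run v')" using c by (auto simp: cut_def)
  have m_nth: "e \<in> set m \<longleftrightarrow> (\<exists>n \<in> {a'..<b'}. e = run v' ! n)" for e
  proof
    assume "e \<in> set m"
    then obtain n where "n < b' - a'" "e = run v' ! (a' + n)"
      using ab' by (auto simp: m_def in_set_conv_nth)
    then show "\<exists>n \<in> {a'..<b'}. e = run v' ! n" by (intro bexI[of _ "a' + n"]) auto
  next
    assume "\<exists>n \<in> {a'..<b'}. e = run v' ! n"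
    then obtain n where n: "n \<in> {a'..<b'}" "e = run v' ! n" by blast
    then have "n - a' < length m" "m ! (n - a') = e" using ab' by (auto simp: m_def)
    then show "e \<in> set m" by (metis nth_mem)
  qed
  have "awalk (start B) p acc"
    unfolding p_def m_def
    using awalk_prefix[OF v(1), of a] awalk_segment[OF v(2) ab'(1)] awalk_suffix[OF v(1), of b] st
    by (auto intro!: awalk_appendI)
  moreover have "activated B (input_of k v) e" if e: "e \<in> set m" for e
  proof -
    have "e \<in> set (run v')" using e by (auto simp: m_def dest: in_set_takeD in_set_dropD)
    then obtain x where x: "e \<in> arcs (graph B)" "slabel B (tail (graph B) e) = Query x"
      "elabel B e = input_of k v' x"
      using fin_computation_run[OF v(2)] by (auto simp: fin_computation_def activated_def)
    have "qnode e \<notin> J" using e c(2) by (auto simp: m_nth cut_def)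
    then have "input_of k v x = input_of k v' x"
    proof (cases x)
      case (Fn i r s)
      then have "qnode e = i" using x(2) by (simp add: qnode_def)
      then show ?thesis using eq[of i] \<open>qnode e \<notin> J\<close> Fn by (simp add: input_of_def)
    next
      \<comment> \<open>Here \<open>qnode e\<close> is 0 and says nothing about \<open>i\<close>;
        agreement follows because \<open>J\<close> contains no leaf.\<close>
      case (Leaf i)
      show ?thesis
      proof (cases "i \<in> {8..15}")
        case True
        then have "i \<notin> J" using J by auto
        then show ?thesis using eq[of i] True Leaf by simp
      next
        case False
        then have "x \<notin> bt_vars k" using Leaf by (auto simp: bt_vars_def)
        then show ?thesis by (simp add: input_of_def)
      qed
    qed
    then show ?thesis using x by (auto simp: activated_def)
  qed
  moreover have "activated B (input_of k v) e" if "e \<in> set (run v)" for e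
    using that fin_computation_run[OF v(1)] by (auto simp: fin_computation_def)
  ultimately have p: "fin_computation B (input_of k v) p acc"
    using fin_computation_run[OF v(1)]
    by (auto simp: fin_computation_def p_def dest: in_set_takeD in_set_dropD)
  have "v j = v' j" if j: "j \<in> J" for j
  proof -
    obtain n where n: "n \<in> {a'..<b'}" "qnode (run v' ! n) = j div 2"
      using c(2) j by (auto simp: cut_def)
    have i: "j div 2 \<in> {1..7}" using j J by force
    \<comment> \<open>This arc occurs both in the spliced computation on \<open>v\<close> and in the
      one on \<open>v'\<close>, so the single label of its tail names the child values of
      both.\<close>
    have "run v' ! n \<in> set p" using n(1) m_nth by (auto simp: p_def)
    from slabel_tail[OF v(1) p this n(2) i]
    have 1: "slabel B (tail (graph B) (run v' ! n))
      = Query (Fn (j div 2) (v (2 * (j div 2))) (v (2 * (j div 2) + 1)))" .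
    have "run v' ! n \<in> set (run v')" using n(1) ab' by auto
    from slabel_tail[OF v(2) fin_computation_run[OF v(2)] this n(2) i] 1
    have "v (2 * (j div 2)) = v' (2 * (j div 2))" "v (2 * (j div 2) + 1) = v' (2 * (j div 2) + 1)"
      by auto
    then show ?thesis by (cases "even j") auto
  qed
  then show ?thesis using eq by blast
qed

section \<open>Counting states\<close>

definition query_states :: "nat \<Rightarrow> nat \<Rightarrow> nat \<Rightarrow> 'q set" where
  "query_states i a b = {q \<in> verts (graph B). slabel B q = Query (Fn i a b)}"

text \<open>The threshold is small enough that seven nodes offer about \<open>7 * k / 100\<close>
  states as cut ends, whose square, taken seven times, stays well below
  \<open>k ^ 2\<close>.\<close>

definition light :: "nat \<Rightarrow> nat \<Rightarrow> nat \<Rightarrow> bool" where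
  "light i a b \<longleftrightarrow> real (card (query_states i a b)) \<le> real k / 100"

definition light_valuations :: "(nat \<Rightarrow> nat) set" where
  "light_valuations = {v \<in> V. \<forall>i \<in> {1..7}. light i (v (2 * i)) (v (2 * i + 1))}"

lemma finite_verts: "finite (verts (graph B))"
  using nbp by (simp add: is_nbp_def)

lemma finite_query_states: "finite (query_states i a b)"
  using finite_verts by (simp add: query_states_def)

lemma finite_V: "finite V"
  by (intro finite_PiE) (auto simp: root_one_values_def)

text \<open>A state has one label, so the sets of query states for different pairs are disjoint, and
  each heavy pair takes more than \<open>k / 100\<close> states.\<close>

lemma card_heavy_pairs:
  "real (card {(a, b) \<in> {1..k} \<times> {1..k}. \<not> light i a b}) * (real k / 100) \<le> real (nbp_size B)"
proof -
  let ?H = "{(a, b) \<in> {1..k} \<times> {1..k}. \<not> light i a b}"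
  have fH: "finite ?H" by (rule finite_subset[of _ "{1..k} \<times> {1..k}"]) auto
  have "real (card ?H) * (real k / 100)
      \<le> (\<Sum>(a, b) \<in> ?H. real (card (query_states i a b)))"
    using sum_bounded_below[of ?H "real k / 100" "\<lambda>(a, b). real (card (query_states i a b))"]
    by (auto simp: light_def)
  also have "\<dots> = real (card (\<Union>(a, b) \<in> ?H. query_states i a b))"
    using fH by (subst card_UN_disjoint)
      (auto simp: finite_query_states query_states_def finite_verts split_def)
  also have "\<dots> \<le> real (nbp_size B)"
    unfolding nbp_size_def of_nat_le_iff
    by (intro card_mono finite_verts) (auto simp: query_states_def)
  finally show ?thesis .
qed

text \<open>A heavy pair fixes two coordinates and leaves \<open>k ^ 12\<close> choices for the
  rest.\<close>

lemma card_heavy_at: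
  assumes i: "i \<in> {1..7}"
  shows "real (card {v \<in> V. \<not> light i (v (2 * i)) (v (2 * i + 1))}) \<le> 100 * real (nbp_size B) * real k ^ 11"
proof -
  let ?H = "{(a, b) \<in> {1..k} \<times> {1..k}. \<not> light i a b}"
  let ?A = "{v \<in> V. \<not> light i (v (2 * i)) (v (2 * i + 1))}"
  let ?I = "{1..15} - {2 * i, 2 * i + 1}"
  let ?R = "Pi\<^sub>E ?I (root_one_values k)"
  have fH: "finite ?H" by (rule finite_subset[of _ "{1..k} \<times> {1..k}"]) auto
  have fR: "finite ?R" by (intro finite_PiE) (auto simp: root_one_values_def)
  let ?f = "\<lambda>v. ((v (2 * i), v (2 * i + 1)), restrict v ?I)"
  have "card ?A \<le> card (?H \<times> ?R)"
  proof (rule card_inj_on_le[of ?f])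
    show "inj_on ?f ?A"
    proof (rule inj_onI)
      fix v v' assume v: "v \<in> ?A" "v' \<in> ?A" "?f v = ?f v'"
      show "v = v'"
      proof (rule PiE_ext[of v "{1..15}" "root_one_values k"])
        fix j :: nat assume j: "j \<in> {1..15}"
        from v(3) have "restrict v ?I j = restrict v' ?I j" by (metis Pair_inject)
        then show "v j = v' j" using v(3) j by (cases "j \<in> ?I") auto
      qed (use v in auto)
    qed
    show "?f ` ?A \<subseteq> ?H \<times> ?R"
    proof
      fix y assume "y \<in> ?f ` ?A"
      then obtain v where v: "v \<in> ?A" "y = ?f v" by blast
      have V: "v \<in> V" using v by simp
      have "v (2 * i) \<in> {1..k}" by (rule Pi_mem[OF V_range[OF V]]) (use i in auto)
      moreover have "v (2 * i + 1) \<in> {1..k}" by (rule Pi_mem[OF V_range[OF V]]) (use i in auto)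
      moreover have "restrict v ?I \<in> ?R" using V by (simp add: PiE_iff)
      ultimately show "y \<in> ?H \<times> ?R" using v by simp
    qed
    show "finite (?H \<times> ?R)" using fH fR by simp
  qed
  also have "\<dots> = card ?H * k ^ 12"
    using card_root_one_valuations[of "{2 * i, 2 * i + 1}" k] i
    by (simp add: card_cartesian_product)
  finally have "real (card ?A) \<le> real (card ?H * k ^ 12)" by (rule of_nat_mono)
  also have "\<dots> = real (card ?H) * real k ^ 12" by simp
  \<comment> \<open>One factor \<open>k\<close> is split off to match
    \<open>card_heavy_pairs\<close>.\<close>
  also have "\<dots> = 100 * (real (card ?H) * (real k / 100)) * real k ^ 11"
    by (simp add: numeral_eq_Suc)
  also have "\<dots> \<le> 100 * real (nbp_size B) * real k ^ 11"
    by (intro mult_right_mono mult_left_mono card_heavy_pairs) auto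
  finally show ?thesis .
qed

text \<open>This confines the ends of a cut to a set determined by the values outside
  \<open>J\<close>.\<close>

lemma st_cut:
  assumes v: "v \<in> light_valuations" and n: "n \<le> length (run v)"
    and g: "n = 0 \<or> n = length (run v) \<or> good J (qnode (run v ! n))"
  shows "st v n \<in> {start B, acc} \<union>
    (\<Union>i \<in> {i. good J i \<and> light i (v (2 * i)) (v (2 * i + 1))}. query_states i (v (2 * i)) (v (2 * i + 1)))"
proof (cases "n = 0 \<or> n = length (run v)")
  case True
  then show ?thesis using v st_0 st_length by (auto simp: light_valuations_def)
next
  case False
  let ?i = "qnode (run v ! n)"
  have vV: "v \<in> V" using v by (simp add: light_valuations_def)
  have g: "good J ?i" and n: "n < length (run v)" using g n False by auto
  have "st v n \<in> verts (graph B)" using awalk_prefix[OF vV] by (rule awalk_last_in_verts)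
  then have "st v n \<in> query_states ?i (v (2 * ?i)) (v (2 * ?i + 1))"
    using slabel_tail[OF vV fin_computation_run[OF vV], of "run v ! n" ?i] n g st_tail[OF vV n]
    by (auto simp: query_states_def good_def)
  moreover have "light ?i (v (2 * ?i)) (v (2 * ?i + 1))"
    using v g by (simp add: light_valuations_def good_def)
  ultimately show ?thesis using g by blast
qed

text \<open>By \<open>splice\<close>, a valuation is recovered from its restriction outside
  \<open>J\<close>, with \<open>k ^ 12\<close> possibilities, and the two end states of its
  cut.\<close>

lemma card_light_cut:
  assumes J: "J \<subseteq> {2..7}" "card J = 2"
  shows "real (card {v \<in> light_valuations. \<exists>a b. cut_at J v a b})
    \<le> real k ^ 12 * (2 + 7 * (real k / 100)) ^ 2"
proof -
  let ?F = "{v \<in> light_valuations. \<exists>a b. cut_at J v a b}"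
  let ?I = "{1..15} - J"
  let ?R = "Pi\<^sub>E ?I (root_one_values k)"
  define S where "S r = {start B, acc} \<union>
    (\<Union>i \<in> {i. good J i \<and> light i (r (2 * i)) (r (2 * i + 1))}.
       query_states i (r (2 * i)) (r (2 * i + 1)))" for r :: "nat \<Rightarrow> nat"
  have fR: "finite ?R" by (intro finite_PiE) (auto simp: root_one_values_def)
  have fg: "finite {i. good J i \<and> P i}" for P
    by (rule finite_subset[of _ "{1..7}"]) (auto simp: good_def)
  have fS: "finite (S r)" for r
    using fg finite_query_states by (auto simp: S_def)
  have S_cong: "S r = S r'"
    \<comment> \<open>Only children of good nodes matter, and these lie outside \<open>J\<close>;
      hence \<open>S\<close> is unchanged by restricting a valuation to \<open>?I\<close>.\<close>
    if "\<And>i. good J i \<Longrightarrow> r (2 * i) = r' (2 * i) \<and> r (2 * i + 1) = r' (2 * i + 1)" for r r'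
  proof -
    have "{i. good J i \<and> light i (r (2 * i)) (r (2 * i + 1))}
        = {i. good J i \<and> light i (r' (2 * i)) (r' (2 * i + 1))}"
      by (intro Collect_cong conj_cong refl) (simp only: that)
    then show ?thesis
      unfolding S_def by (intro arg_cong2[of _ _ _ _ "(\<union>)"] SUP_cong) (use that in auto)
  qed
  have cS: "real (card (S r)) \<le> 2 + 7 * (real k / 100)" for r
  proof -
    let ?G = "{i. good J i \<and> light i (r (2 * i)) (r (2 * i + 1))}"
    have "card (S r) \<le> card {start B, acc} + card (\<Union>i \<in> ?G. query_states i (r (2 * i)) (r (2 * i + 1)))"
      unfolding S_def by (rule card_Un_le)
    also have "\<dots> \<le> 2 + (\<Sum>i \<in> ?G. card (query_states i (r (2 * i)) (r (2 * i + 1))))"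
      by (intro add_mono card_UN_le fg) (simp add: card_insert_if)
    finally have "real (card (S r))
        \<le> real (2 + (\<Sum>i \<in> ?G. card (query_states i (r (2 * i)) (r (2 * i + 1)))))"
      by (rule of_nat_mono)
    also have "\<dots> = 2 + (\<Sum>i \<in> ?G. real (card (query_states i (r (2 * i)) (r (2 * i + 1)))))"
      by (simp only: of_nat_add of_nat_numeral of_nat_sum)
    also have "\<dots> \<le> 2 + real (card ?G) * (real k / 100)"
      by (intro add_left_mono sum_bounded_above) (auto simp: light_def)
    also have "\<dots> \<le> 2 + 7 * (real k / 100)"
    proof -
      have "card ?G \<le> card {1..7::nat}" by (rule card_mono) (auto simp: good_def)
      then show ?thesis by (intro add_left_mono mult_right_mono) auto
    qed
    finally show ?thesis .
  qed
  obtain \<alpha> \<beta> where cut: "cut_at J v (\<alpha> v) (\<beta> v)" if "v \<in> ?F" for v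
  proof -
    have "\<forall>v. \<exists>ab. v \<in> ?F \<longrightarrow> cut_at J v (fst ab) (snd ab)" by auto
    from choice[OF this] obtain f
      where "\<forall>v. v \<in> ?F \<longrightarrow> cut_at J v (fst (f v)) (snd (f v))" ..
    then show ?thesis using that[of "fst \<circ> f" "snd \<circ> f"] by auto
  qed
  let ?f = "\<lambda>v. (restrict v ?I, st v (\<alpha> v), st v (\<beta> v))"
  have "card ?F \<le> card (SIGMA r:?R. S r \<times> S r)"
  proof (rule card_inj_on_le[of ?f])
    show "inj_on ?f ?F"
    proof (rule inj_onI)
      fix v v' assume v: "v \<in> ?F" "v' \<in> ?F" "?f v = ?f v'"
      have V: "v \<in> V" "v' \<in> V" using v by (auto simp: light_valuations_def)
      show "v = v'"
      proof (rule splice[OF V J(1) _ cut[OF v(1)] cut[OF v(2)]])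
        fix i assume i: "i \<notin> J"
        from v(3) have "restrict v ?I i = restrict v' ?I i" by (metis Pair_inject)
        then show "v i = v' i" using i V by (cases "i \<in> {1..15}") (auto simp: PiE_iff extensional_def)
      qed (use v(3) in auto)
    qed
    show "?f ` ?F \<subseteq> (SIGMA r:?R. S r \<times> S r)"
    proof
      fix y assume "y \<in> ?f ` ?F"
      then obtain v where v: "v \<in> ?F" "y = ?f v" by blast
      have R: "restrict v ?I \<in> ?R" using v by (auto simp: PiE_iff light_valuations_def)
      have "S (restrict v ?I) = S v"
        by (rule S_cong) (simp add: good_def)
      then have SS: "S (restrict v ?I) = {start B, acc} \<union>
        (\<Union>i \<in> {i. good J i \<and> light i (v (2 * i)) (v (2 * i + 1))}.
           query_states i (v (2 * i)) (v (2 * i + 1)))"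
        by (simp only: S_def)
      have vl: "v \<in> light_valuations" using v(1) by simp
      have c: "\<alpha> v \<le> length (run v)" "\<beta> v \<le> length (run v)"
        "\<alpha> v = 0 \<or> \<alpha> v = length (run v) \<or> good J (qnode (run v ! \<alpha> v))"
        "\<beta> v = 0 \<or> \<beta> v = length (run v) \<or> good J (qnode (run v ! \<beta> v))"
        using cut[OF v(1)] unfolding cut_def by auto
      have "st v (\<alpha> v) \<in> S (restrict v ?I)" unfolding SS by (rule st_cut[OF vl c(1) c(3)])
      moreover have "st v (\<beta> v) \<in> S (restrict v ?I)" unfolding SS by (rule st_cut[OF vl c(2) c(4)])
      ultimately show "y \<in> (SIGMA r:?R. S r \<times> S r)" using v R by auto
    qed
    show "finite (SIGMA r:?R. S r \<times> S r)" using fR fS by auto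
  qed
  also have "\<dots> = (\<Sum>r \<in> ?R. card (S r) ^ 2)"
    using fR fS by (simp add: card_cartesian_product power2_eq_square)
  finally have "real (card ?F) \<le> real (\<Sum>r \<in> ?R. card (S r) ^ 2)" by (rule of_nat_mono)
  also have "\<dots> = (\<Sum>r \<in> ?R. real (card (S r)) ^ 2)"
    by (simp only: of_nat_sum of_nat_power)
  also have "\<dots> \<le> real (card ?R) * (2 + 7 * (real k / 100)) ^ 2"
    by (intro sum_bounded_above power_mono cS) auto
  also have "card ?R = k ^ 12"
    using card_root_one_valuations[of J k] J by force
  finally show ?thesis by simp
qed

section \<open>Combining the two counts\<close>

lemma cut_pairs_cover:
  assumes "v \<in> V"
  shows "\<exists>J \<in> cut_pairs. \<exists>a b. cut_at J v a b"
proof -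
  obtain n where "n < length (run v)" "qnode (run v ! n) = 1"
    using root_queried[OF assms] by (auto simp: in_set_conv_nth)
  then show ?thesis using cut_exists by fastforce
qed

text \<open>Each of the \<open>k ^ 14\<close> valuations is heavy at one of seven nodes or is light
  with a cut for one of seven pairs.\<close>

lemma size_bound:
  "real k ^ 14 \<le> 700 * real (nbp_size B) * real k ^ 11
     + 7 * (real k ^ 12 * (2 + 7 * (real k / 100)) ^ 2)"
proof -
  let ?A = "\<lambda>i. {v \<in> V. \<not> light i (v (2 * i)) (v (2 * i + 1))}"
  let ?F = "\<lambda>J. {v \<in> light_valuations. \<exists>a b. cut_at J v a b}"
  have c: "cut_pairs = set [{2, 3}, {4, 5}, {6, 7}, {2, 6}, {2, 7}, {3, 4}, {3, 5}]"
    by (simp only: cut_pairs_def list.set)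
  have fc: "finite cut_pairs" unfolding c by (rule finite_set)
  \<comment> \<open>The length of the list bounds the cardinality.\<close>
  have cc: "card cut_pairs \<le> 7" unfolding c by (rule order.trans[OF card_length]) simp
  have Jp: "J \<subseteq> {2..7} \<and> card J = 2" if "J \<in> cut_pairs" for J
    using that by (auto simp: cut_pairs_def)
  have "V \<subseteq> (\<Union>i \<in> {1..7}. ?A i) \<union> (\<Union>J \<in> cut_pairs. ?F J)"
    using cut_pairs_cover by (auto simp: light_valuations_def)
  moreover have "finite ((\<Union>i \<in> {1..7}. ?A i) \<union> (\<Union>J \<in> cut_pairs. ?F J))"
    by (rule finite_subset[OF _ finite_V]) (auto simp: light_valuations_def)
  ultimately have "card V \<le> card ((\<Union>i \<in> {1..7}. ?A i) \<union> (\<Union>J \<in> cut_pairs. ?F J))"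
    by (intro card_mono)
  also have "\<dots> \<le> (\<Sum>i \<in> {1..7}. card (?A i)) + (\<Sum>J \<in> cut_pairs. card (?F J))"
    by (intro order.trans[OF card_Un_le] add_mono card_UN_le fc) auto
  finally have "real (card V)
      \<le> real ((\<Sum>i \<in> {1..7}. card (?A i)) + (\<Sum>J \<in> cut_pairs. card (?F J)))"
    by (rule of_nat_mono)
  also have "\<dots> = (\<Sum>i \<in> {1..7}. real (card (?A i))) + (\<Sum>J \<in> cut_pairs. real (card (?F J)))"
    by (simp only: of_nat_add of_nat_sum)
  also have "\<dots> \<le> real (card {1..7::nat}) * (100 * real (nbp_size B) * real k ^ 11)
      + real (card cut_pairs) * (real k ^ 12 * (2 + 7 * (real k / 100)) ^ 2)"
    by (intro add_mono sum_bounded_above card_heavy_at card_light_cut) (use Jp in auto)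
  also have "\<dots> \<le> 7 * (100 * real (nbp_size B) * real k ^ 11)
      + 7 * (real k ^ 12 * (2 + 7 * (real k / 100)) ^ 2)"
    using cc by (intro add_mono mult_right_mono) auto
  finally show ?thesis using card_root_one_valuations[of "{}" k] by simp
qed

text \<open>For \<open>50 \<le> k\<close> the additive 2 is at most \<open>4 / 100 * k\<close>, so
  cut valuations make up at most the fraction \<open>7 * (11 / 100) ^ 2 = 847 / 10000\<close>. The
  rest is heavy, and \<open>9153 / 10000\<close> divided by 700 exceeds
  \<open>1 / 1000\<close>.\<close>

lemma cubic_lower_bound:
  assumes k: "50 \<le> k"
  shows "1 / 1000 * real k ^ 3 \<le> real (nbp_size B)"
proof -
  let ?k = "real k" and ?N = "real (nbp_size B)"
  have sq: "7 * (a * (11 / 100 * b) ^ 2) = 847 / 10000 * (a * b ^ 2)" for a b :: real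
    by (simp add: power2_eq_square)
  have k14: "?k ^ 14 = ?k ^ 12 * ?k ^ 2" by (simp flip: power_add)
  have "2 + 7 * (?k / 100) \<le> 11 / 100 * ?k" using k by simp
  then have "(2 + 7 * (?k / 100)) ^ 2 \<le> (11 / 100 * ?k) ^ 2" by (intro power_mono) auto
  then have "7 * (?k ^ 12 * (2 + 7 * (?k / 100)) ^ 2) \<le> 7 * (?k ^ 12 * (11 / 100 * ?k) ^ 2)"
    by (intro mult_left_mono) auto
  also have "\<dots> = 847 / 10000 * ?k ^ 14"
    unfolding k14 by (rule sq)
  finally have "?k ^ 14 \<le> 700 * ?N * ?k ^ 11 + 847 / 10000 * ?k ^ 14" using size_bound by linarith
  then have "9153 / 10000 * (?k ^ 3 * ?k ^ 11) \<le> 700 * ?N * ?k ^ 11" by (simp flip: power_add)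
  then have "(9153 / 10000 * ?k ^ 3) * ?k ^ 11 \<le> (700 * ?N) * ?k ^ 11" by (simp only: mult.assoc)
  then have "9153 / 10000 * ?k ^ 3 \<le> 700 * ?N"
    by (rule mult_right_le_imp_le) (use k in simp)
  moreover have "0 \<le> ?k ^ 3" by simp
  ultimately show ?thesis by linarith
qed

end

theorem theorem5p12:
  shows "\<exists>c::real. c > 0 \<and> (\<exists>k0::nat. \<forall>k\<ge>k0. \<forall>B :: ('q, 'e, bt_var, bool) nbp.
           solves_BT k B \<and> thrifty k B \<longrightarrow> c * real k ^ 3 \<le> real (nbp_size B))"
proof (intro exI[of _ "1 / 1000"] exI[of _ 50] conjI allI impI)
  fix k :: nat and B :: "('q, 'e, bt_var, bool) nbp"
  assume k: "50 \<le> k" and "solves_BT k B \<and> thrifty k B"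
  then interpret thrifty_program k B by unfold_locales auto
  show "1 / 1000 * real k ^ 3 \<le> real (nbp_size B)" using k by (rule cubic_lower_bound)
qed simp

end
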